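(* Let $n \ge 3$ and $g \ge 2$ be integers. Then there are only finitely many connected surfaces $X$ such that $X$ is a cyclically branched cover over an $n$-punctured sphere (of some degree $d$ and with some branching indices $(d_1,\dots,d_n)$) and $\mathrm{genus}(X)=g$; here covers are counted by their defining data $(d;d_1,\dots,d_n)$. Moreover, the degree $d$ of any such covering satisfies $$d \le 84(g-1)\quad\text{if } n=3,\qquad d\le 12(g-1)\quad\text{if } n=4,$$ and $$\frac{2g}{n-2}+1\;\le\; d\;\le\;\frac{4(g-1)}{n-4}\quad\text{if } n\ge 5.$$
   Context: Construction of a $d$-fold cyclically branched cover over an $n$-punctured sphere with branching indices $(d_1,\dots,d_n)$. Let $p_1,\dots,p_n$ be distinct points of the 2-sphere $\mathbb{S}^2$, let $q\in \mathbb{S}^2\setminus\{p_1,\dots,p_n\}$ be a base point, and let $Y=\mathbb{S}^2\setminus\{p_1,\dots,p_n\}$. Let $\gamma_i$ (branch cuts) be simple curves from $q$ to $p_i$, mutually disjoint except at $q$, with left side $\gamma_i^l$ and right side $\gamma_i^r$. Let $d\ge 2$ and $d_i\in\{1,\dots,d-1\}$ with $\sum_{i=1}^n d_i\equiv 0 \pmod d$. Take $d$ copies (sheets) $Y_1,\dots,Y_d$ of $Y$ slit along the branch cuts, with sheet indices read modulo $d$, and for all $i,j$ identify $\gamma_i^l$ of $Y_j$ with $\gamma_i^r$ of $Y_{j+d_i \,(\mathrm{mod}\, d)}$. Filling in the points over the $p_i$ gives a closed surface $X$ with a branched covering of degree $d$ onto $\mathbb{S}^2$, branched only over the $p_i$;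 the cyclic group $\mathbb{Z}/d\mathbb{Z}$ acts on $X$ by $Y_j\mapsto Y_{j+1}$ with quotient the sphere. Up to homeomorphism the covering depends only on $d$ and $(d_1,\dots,d_n)$. *)

theory Defs
  imports "HOL-Analysis.Analysis"
begin

section \<open>Slitting the sphere along branch cuts\<close>

definition branch_cuts ::
  "nat \<Rightarrow> (nat \<Rightarrow> real^3) \<Rightarrow> real^3 \<Rightarrow> (nat \<Rightarrow> real \<Rightarrow> real^3) \<Rightarrow> bool" where
  "branch_cuts n p q \<gamma> \<longleftrightarrow>
     p ` {..<n} \<subseteq> sphere 0 1 \<and> inj_on p {..<n} \<and> q \<in> sphere 0 1 - p ` {..<n} \<and>
     (\<forall>i<n. arc (\<gamma> i) \<and> path_image (\<gamma> i) \<subseteq> sphere 0 1 \<and>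
            pathstart (\<gamma> i) = q \<and> pathfinish (\<gamma> i) = p i) \<and>
     (\<forall>i<n. \<forall>k<n. i \<noteq> k \<longrightarrow> path_image (\<gamma> i) \<inter> path_image (\<gamma> k) = {q})"

text \<open>
  The sphere slit along \<open>n\<close> branch cuts is a closed disc whose boundary circle runs once along both
  sides of each cut. The circle is divided into \<open>2 * n\<close> equal arcs; walking around it
  counterclockwise, with the interior of the disc on the left, the \<open>k\<close>-th pair of arcs follows a cut
  from \<open>q\<close> to its end point along the left side of the cut, and then returns to \<open>q\<close> along its right
  side. Both sides are parametrised by the parameter of the cut itself, so \<open>t = 0\<close> lies over \<open>q\<close>.
\<close>

definition left_side :: "nat \<Rightarrow> nat \<Rightarrow> real \<Rightarrow> complex" where
  "left_side n k t = cis (pi * (2 * real k + t) / real n)"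

definition right_side :: "nat \<Rightarrow> nat \<Rightarrow> real \<Rightarrow> complex" where
  "right_side n k t = cis (pi * (2 * real k + 2 - t) / real n)"

text \<open>
  \<open>\<phi>\<close> maps the slit sphere back to the sphere. The bijection \<open>s\<close> records the cyclic order in which the
  cuts leave \<open>q\<close>: cut \<open>i\<close> is the \<open>s i\<close>-th one met along the boundary of the disc. The sphere is
  oriented by \<open>\<phi>\<close>.
\<close>

definition slit_sphere ::
  "nat \<Rightarrow> (nat \<Rightarrow> real \<Rightarrow> real^3) \<Rightarrow> (complex \<Rightarrow> real^3) \<Rightarrow> (nat \<Rightarrow> nat) \<Rightarrow> bool" where
  "slit_sphere n \<gamma> \<phi> s \<longleftrightarrow>
     continuous_on (cball 0 1) \<phi> \<and> inj_on \<phi> (ball 0 1) \<and>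
     \<phi> ` ball 0 1 = sphere 0 1 - (\<Union>i<n. path_image (\<gamma> i)) \<and>
     bij_betw s {..<n} {..<n} \<and>
     (\<forall>i<n. \<forall>t\<in>{0..1}. \<phi> (left_side n (s i) t) = \<gamma> i t \<and> \<phi> (right_side n (s i) t) = \<gamma> i t)"

section \<open>Cyclically branched covers\<close>

definition branching_data :: "nat \<Rightarrow> nat \<Rightarrow> nat list \<Rightarrow> bool" where
  "branching_data n d ds \<longleftrightarrow>
     d \<ge> 2 \<and> length ds = n \<and> set ds \<subseteq> {1..d - 1} \<and> sum_list ds mod d = 0"

definition sheets :: "nat \<Rightarrow> (nat \<times> complex) topology" where
  "sheets d = prod_topology (discrete_topology {..<d}) (top_of_set (cball 0 1))"

inductive side_gluing ::
  "nat \<Rightarrow> nat \<Rightarrow> nat list \<Rightarrow> (nat \<Rightarrow> nat) \<Rightarrow> nat \<times> complex \<Rightarrow> nat \<times> complex \<Rightarrow> bool"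
  for n d ds s where
  "\<lbrakk>i < n; j < d; 0 \<le> t; t \<le> 1\<rbrakk> \<Longrightarrow>
     side_gluing n d ds s (j, left_side n (s i) t) ((j + ds ! i) mod d, right_side n (s i) t)"

text \<open>
  \<open>X\<close> with projection \<open>f\<close> is the quotient of the \<open>d\<close> sheets by the equivalence relation that the
  gluing of the sides generates. It is given up to homeomorphism, by a quotient map \<open>\<pi>\<close>. The sheets
  are closed discs, so they contain the end points of the sides: identifying those as well
  (\<open>t = 1\<close>) yields one point over \<open>p i\<close> for each orbit of the shift by \<open>ds ! i\<close> on the sheets, which
  is how the punctures of the glued surface are filled in.
\<close>

definition cyclic_branched_cover_over ::
  "nat \<Rightarrow> (nat \<Rightarrow> real^3) \<Rightarrow> nat \<Rightarrow> nat list \<Rightarrow> 'a topology \<Rightarrow> ('a \<Rightarrow> real^3) \<Rightarrow> bool" where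
  "cyclic_branched_cover_over n p d ds X f \<longleftrightarrow>
     branching_data n d ds \<and>
     (\<exists>q \<gamma> \<phi> s \<pi>.
        branch_cuts n p q \<gamma> \<and> slit_sphere n \<gamma> \<phi> s \<and>
        quotient_map (sheets d) X \<pi> \<and>
        (\<forall>a\<in>topspace (sheets d). \<forall>b\<in>topspace (sheets d).
            \<pi> a = \<pi> b \<longleftrightarrow> equivclp (side_gluing n d ds s) a b) \<and>
        (\<forall>j<d. \<forall>z\<in>cball 0 1. f (\<pi> (j, z)) = \<phi> z))"

definition cyclic_branched_cover :: "nat \<Rightarrow> nat \<Rightarrow> nat list \<Rightarrow> 'a topology \<Rightarrow> bool" where
  "cyclic_branched_cover n d ds X \<longleftrightarrow> (\<exists>p f. cyclic_branched_cover_over n p d ds X f)"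

section \<open>Genus\<close>

definition closed_surface :: "'a topology \<Rightarrow> bool" where
  "closed_surface X \<longleftrightarrow>
     compact_space X \<and> Hausdorff_space X \<and>
     (\<forall>x\<in>topspace X. \<exists>U. openin X U \<and> x \<in> U \<and>
        subtopology X U homeomorphic_space top_of_set (ball (0::complex) 1))"

text \<open>
  A finite CW structure of dimension at most 2: \<open>V\<close> is the set of vertices, \<open>E\<close> and \<open>F\<close> are the sets
  of open edges and open faces.
\<close>

definition cell_decomposition :: "'a topology \<Rightarrow> 'a set \<Rightarrow> 'a set set \<Rightarrow> 'a set set \<Rightarrow> bool" where
  "cell_decomposition X V E F \<longleftrightarrow>
     finite V \<and> finite E \<and> finite F \<and>
     V \<union> \<Union>E \<union> \<Union>F = topspace X \<and>
     V \<inter> \<Union>E = {} \<and> V \<inter> \<Union>F = {} \<and> \<Union>E \<inter> \<Union>F = {} \<and> disjoint E \<and> disjoint F \<and>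
     (\<forall>e\<in>E. \<exists>h. continuous_map (top_of_set {0..1::real}) X h \<and>
        inj_on h {0<..<1} \<and> h ` {0<..<1} = e \<and> h ` {0, 1} \<subseteq> V) \<and>
     (\<forall>c\<in>F. \<exists>h. continuous_map (top_of_set (cball (0::complex) 1)) X h \<and>
        inj_on h (ball 0 1) \<and> h ` ball 0 1 = c \<and> h ` sphere 0 1 \<subseteq> V \<union> \<Union>E)"

text \<open>
  The Euler characteristic is the common value of \<open>V - E + F\<close> over all finite cell decompositions.
\<close>

definition has_euler_characteristic :: "'a topology \<Rightarrow> int \<Rightarrow> bool" where
  "has_euler_characteristic X k \<longleftrightarrow>
     (\<exists>V E F. cell_decomposition X V E F) \<and>
     (\<forall>V E F. cell_decomposition X V E F \<longrightarrow> int (card V) - int (card E) + int (card F) = k)"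

text \<open>
  This is the genus of connected orientable surfaces. The covers above are orientable, because every
  side is glued to one that the boundary of its disc traverses in the opposite direction.
\<close>

definition has_genus :: "'a topology \<Rightarrow> nat \<Rightarrow> bool" where
  "has_genus X g \<longleftrightarrow> closed_surface X \<and> has_euler_characteristic X (2 - 2 * int g)"

end

theory Submission
  imports Defs
begin

text \<open>
  The images of the open discs, of the open left sides and of the end points of the sides form a
  cell decomposition of the cover with \<open>d\<close> faces, \<open>n * d\<close> edges, \<open>d\<close> vertices over \<open>q\<close> (the monodromy
  around \<open>q\<close> is the sum of all shifts, which is trivial) and \<open>gcd d d\<^sub>i\<close> vertices over \<open>p\<^sub>i\<close>. Hence
  \<open>2 * g - 2 = d * (n - 2) - (\<Sum>i<n. gcd d d\<^sub>i)\<close>. Each \<open>gcd d d\<^sub>i\<close> is at least \<open>1\<close>, and it is \<open>d / e\<^sub>i\<close>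
  with \<open>e\<^sub>i \<ge> 2\<close>, so the bounds on \<open>d\<close> reduce to the possible values of sums of \<open>n\<close> unit fractions below
  \<open>n - 2\<close>. Neither the bounds nor the count needs more than one cell decomposition, because the Euler
  characteristic is by assumption the same for all of them.
\<close>

section \<open>The gluing of the sheets\<close>

text \<open>Values of a complete invariant of the gluing. Sheet numbers that arise by subtracting
  shifts are integers, since subtraction on \<open>nat\<close> would truncate before the reduction
  mod \<open>d\<close>.\<close>

datatype cell_point =
    Over_base int | Over_end nat nat | On_edge nat real int | In_face nat complex

section \<open>Coordinates on the boundary circle of the slit sphere\<close>

text \<open>Unrolls the circle onto [0, 2n): left side \<open>k\<close> occupies [2k, 2k+1], and
  right side \<open>k\<close> occupies [2k+1, 2k+2] with its parameter running backwards.\<close>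

definition boundary_param :: "nat \<Rightarrow> complex \<Rightarrow> real" where
  "boundary_param n z = Arg2pi z * real n / pi"

lemma boundary_param_cis:
  assumes "0 \<le> u" "u < 2 * real n"
  shows "boundary_param n (cis (pi * u / real n)) = u"
proof -
  have n: "real n > 0" using assms by linarith
  have "pi * u / real n < 2 * pi"
    using n assms(2) by (simp add: field_simps)
  then have "Arg2pi (cis (pi * u / real n)) = pi * u / real n"
    using assms(1) n by (intro Arg2pi_unique[of 1]) (auto simp: cis_conv_exp)
  then show ?thesis using n by (simp add: boundary_param_def)
qed

lemma cis_boundary_param:
  assumes "norm z = 1" "n > 0"
  shows "cis (pi * boundary_param n z / real n) = z"
  using assms complex_norm_eq_1_exp[of z] by (simp add: boundary_param_def cis_conv_exp)

lemma boundary_param_bounds: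
  assumes "n > 0"
  shows "0 \<le> boundary_param n z" "boundary_param n z < 2 * real n"
  using assms Arg2pi_ge_0[of z] Arg2pi_lt_2pi[of z] by (auto simp: boundary_param_def field_simps)

lemma norm_left_side [simp]: "norm (left_side n k t) = 1"
  by (simp add: left_side_def)

lemma norm_right_side [simp]: "norm (right_side n k t) = 1"
  by (simp add: right_side_def)

lemma right_side_1: "right_side n k 1 = left_side n k 1"
  by (simp add: right_side_def left_side_def add_ac)

lemma right_side_0: "right_side n k 0 = left_side n (Suc k) 0"
  by (simp add: right_side_def left_side_def algebra_simps)

lemma left_side_wrap: "n > 0 \<Longrightarrow> left_side n n 0 = left_side n 0 0"
  using cis_2pi by (simp add: left_side_def mult.commute)

text \<open>Right sides are needed only for \<open>0 < t\<close> and \<open>t < 1\<close>, because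
  their end points already lie on left sides.\<close>

lemma unit_circle_cases:
  assumes "norm z = 1" "n > 0"
  obtains (left) k t where "k < n" "0 \<le> t" "t \<le> 1" "z = left_side n k t"
    | (right) k t where "k < n" "0 < t" "t < 1" "z = right_side n k t"
proof -
  define u where "u = boundary_param n z"
  define k where "k = nat \<lfloor>u / 2\<rfloor>"
  have u: "0 \<le> u" "u < 2 * real n" "cis (pi * u / real n) = z"
    using boundary_param_bounds cis_boundary_param assms unfolding u_def by auto
  have k: "2 * real k \<le> u" "u < 2 * real k + 2"
    using u(1) unfolding k_def by linarith+
  have kn: "k < n" using k(1) u(2) by linarith
  show thesis
  proof (cases "u - 2 * real k \<le> 1")
    case True
    then show ?thesis
      using left[of k "u - 2 * real k"] k kn u by (simp add: left_side_def)
  next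
    case False
    then show ?thesis
      using right[of k "2 * real k + 2 - u"] k kn u by (simp add: right_side_def)
  qed
qed

section \<open>The gluing relation and its invariant\<close>

locale cyclic_gluing =
  fixes n d :: nat and D :: "nat \<Rightarrow> nat"
  assumes n_pos: "n > 0" and d_pos: "d > 0" and total_shift: "(\<Sum>k<n. D k) mod d = 0"
begin

text \<open>This is \<open>side_gluing\<close> with the cuts renumbered by their position along the
  boundary, so that partial sums of \<open>D\<close> follow the walk around the base point.\<close>

inductive glue :: "nat \<times> complex \<Rightarrow> nat \<times> complex \<Rightarrow> bool" where
  "\<lbrakk>k < n; j < d; 0 \<le> t; t \<le> 1\<rbrakk> \<Longrightarrow>
     glue (j, left_side n k t) ((j + D k) mod d, right_side n k t)"

text \<open>
  A complete invariant of the gluing. Points on a cut are named by the sheet whose left side contains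
  them. The corners over \<open>q\<close> are carried back to corner \<open>0\<close> by the partial sums of the shifts, and the
  end points over a branch point are identified along the orbits of its shift.
\<close>

definition label :: "nat \<times> complex \<Rightarrow> cell_point" where
  "label a = (case a of (j, z) \<Rightarrow>
     if norm z < 1 then In_face j z else
       let u = boundary_param n z; k = nat \<lfloor>u / 2\<rfloor>; t = u - 2 * real k in
         if t = 0 then Over_base ((int j - int (\<Sum>l<k. D l)) mod int d)
         else if t < 1 then On_edge k t (int j)
         else if t = 1 then Over_end k (j mod gcd d (D k))
         else On_edge k (2 - t) ((int j - int (D k)) mod int d))"

lemma label_face: "norm z < 1 \<Longrightarrow> label (j, z) = In_face j z"
  by (simp add: label_def)

lemma label_left:
  assumes "k < n" "0 \<le> t" "t \<le> 1"
  shows "label (j, left_side n k t) =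
    (if t = 0 then Over_base ((int j - int (\<Sum>l<k. D l)) mod int d)
     else if t < 1 then On_edge k t (int j) else Over_end k (j mod gcd d (D k)))"
proof -
  have "boundary_param n (left_side n k t) = 2 * real k + t"
    unfolding left_side_def using assms by (intro boundary_param_cis) auto
  moreover have "\<lfloor>(2 * real k + t) / 2\<rfloor> = int k"
    using assms by (intro floor_unique) auto
  ultimately show ?thesis
    using assms by (simp only: label_def prod.case Let_def nat_int norm_left_side) auto
qed

lemma label_right:
  assumes "k < n" "0 < t" "t < 1"
  shows "label (j, right_side n k t) = On_edge k t ((int j - int (D k)) mod int d)"
proof -
  have "boundary_param n (right_side n k t) = 2 * real k + 2 - t"
    unfolding right_side_def using assms by (intro boundary_param_cis) auto
  moreover have "\<lfloor>(2 * real k + 2 - t) / 2\<rfloor> = int k"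
    using assms by (intro floor_unique) auto
  ultimately show ?thesis using assms by (auto simp: label_def Let_def)
qed

lemma label_glue:
  assumes "glue a b"
  shows "label a = label b"
  using assms
proof cases
  case (1 k j t)
  consider "t = 0" | "0 < t" "t < 1" | "t = 1" using 1 by linarith
  then show ?thesis
  proof cases
    case t: 1
    \<comment> \<open>Passing from corner \<open>k\<close> to corner \<open>Suc k\<close> adds
      \<open>D k\<close> both to the sheet and to the partial sum, so the difference survives mod
      \<open>d\<close>.\<close>
    have corner: "(int ((j + D k) mod d) - int (\<Sum>l<Suc k. D l)) mod int d =
        (int j - int (\<Sum>l<k. D l)) mod int d"
      by (simp add: zmod_int mod_diff_left_eq)
    show ?thesis
    proof (cases "Suc k < n")
      case True
      then show ?thesis using 1 t corner by (simp add: right_side_0 label_left)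
    next
      case False
      then have n: "n = Suc k" using 1 by simp
      \<comment> \<open>The corner after the last cut is corner \<open>0\<close> again; the walk
        closes up because the total shift vanishes mod \<open>d\<close>.\<close>
      have "int (\<Sum>l<Suc k. D l) mod int d = 0"
        using total_shift n by (metis of_nat_0 zmod_int)
      then have "(int ((j + D k) mod d) - int (\<Sum>l<Suc k. D l)) mod int d
          = int ((j + D k) mod d) mod int d"
        by (metis diff_zero mod_diff_right_eq)
      moreover have "b = ((j + D k) mod d, left_side n 0 0)"
        using 1 t left_side_wrap[OF n_pos] n by (simp add: right_side_0)
      ultimately have "label b = Over_base ((int j - int (\<Sum>l<k. D l)) mod int d)"
        using n_pos corner label_left[of 0 0] by simp
      then show ?thesis using 1 t by (simp add: label_left)
    qed
  next
    case t: 2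
    have "(int ((j + D k) mod d) - int (D k)) mod int d = int j"
      using 1 by (simp add: zmod_int mod_diff_left_eq)
    then show ?thesis using 1 t by (simp add: label_left label_right)
  next
    case t: 3
    \<comment> \<open>The gcd divides both \<open>d\<close> and \<open>D k\<close>, so neither the
      reduction nor the shift changes the residue.\<close>
    have "(j + D k) mod d mod gcd d (D k) = j mod gcd d (D k)"
      by (metis gcd_dvd1 gcd_dvd2 mod_mod_cancel mod_add_right_eq dvd_imp_mod_0 add_0_right)
    then show ?thesis using 1 t by (simp add: right_side_1 label_left)
  qed
qed

lemma label_equiv: "equivclp glue a b \<Longrightarrow> label a = label b"
  by (induction rule: equivclp_induct) (auto dest: label_glue)

section \<open>Representatives and completeness of the invariant\<close>

text \<open>Over the base point corner \<open>0\<close> is chosen; everywhere else on a cut the left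
  side is chosen.\<close>

fun rep :: "cell_point \<Rightarrow> nat \<times> complex" where
  "rep (Over_base m) = (nat m, left_side n 0 0)"
| "rep (Over_end k m) = (m, left_side n k 1)"
| "rep (On_edge k t m) = (nat m, left_side n k t)"
| "rep (In_face j z) = (j, z)"

text \<open>At \<open>t = 1\<close> both sides meet in the same point of the circle, so a gluing
  there changes only the sheet and can be iterated.\<close>

lemma equiv_over_end_shift:
  assumes "k < n" "j < d"
  shows "equivclp glue (j, left_side n k 1) ((j + m * D k) mod d, left_side n k 1)"
proof (induction m)
  case 0
  then show ?case using assms by simp
next
  case (Suc m)
  have "glue ((j + m * D k) mod d, left_side n k 1)
      (((j + m * D k) mod d + D k) mod d, right_side n k 1)"
    using assms d_pos by (intro glue.intros) auto
  then have "glue ((j + m * D k) mod d, left_side n k 1)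
      ((j + Suc m * D k) mod d, left_side n k 1)"
    by (simp add: right_side_1 mod_simps ac_simps)
  with Suc show ?case by (meson equivclp_trans r_into_equivclp)
qed

lemma equiv_over_end:
  assumes "k < n" "j < d"
  shows "equivclp glue (j, left_side n k 1) (j mod gcd d (D k), left_side n k 1)"
proof (cases "D k = 0")
  case True
  then show ?thesis using assms by simp
next
  case False
  define c where "c = gcd d (D k)"
  \<comment> \<open>By Bezout, \<open>x\<close> shifts by \<open>D k\<close> move the sheet by
    \<open>c\<close> mod \<open>d\<close>; hence \<open>j div c * x\<close> shifts lead from
    \<open>j mod c\<close> to \<open>j\<close>.\<close>
  obtain x y where xy: "D k * x = d * y + c"
    using bezout_nat[OF False, of d] by (auto simp: c_def gcd.commute)
  have "j mod c + (j div c * x) * D k = j mod c + j div c * (D k * x)" by simp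
  also have "\<dots> = j + d * (j div c * y)"
    unfolding xy using mod_div_mult_eq[of j c] by (simp add: algebra_simps)
  finally have "(j mod c + (j div c * x) * D k) mod d = j" using assms by simp
  moreover have "j mod c < d" using assms(2) by (meson le_less_trans mod_less_eq_dividend)
  ultimately have "equivclp glue (j mod c, left_side n k 1) (j, left_side n k 1)"
    using equiv_over_end_shift[of k "j mod c" "j div c * x"] assms by simp
  then show ?thesis unfolding c_def by (rule equivclp_sym)
qed

text \<open>At \<open>t = 0\<close> a gluing leads to the next corner of the disc, so walking around
  the base point accumulates the shifts.\<close>

lemma equiv_over_base_shift:
  assumes "k < n" "m < d"
  shows "equivclp glue (m, left_side n 0 0) ((m + (\<Sum>l<k. D l)) mod d, left_side n k 0)"
  using assms(1)
proof (induction k)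
  case 0
  then show ?case using assms by simp
next
  case (Suc k)
  have "glue ((m + (\<Sum>l<k. D l)) mod d, left_side n k 0)
      (((m + (\<Sum>l<k. D l)) mod d + D k) mod d, right_side n k 0)"
    using Suc d_pos by (intro glue.intros) auto
  then have "glue ((m + (\<Sum>l<k. D l)) mod d, left_side n k 0)
      ((m + (\<Sum>l<Suc k. D l)) mod d, left_side n (Suc k) 0)"
    by (simp add: right_side_0 mod_simps ac_simps)
  with Suc show ?case by (meson equivclp_trans r_into_equivclp Suc_lessD)
qed

lemma equiv_over_base:
  assumes "k < n" "j < d"
  shows "equivclp glue (j, left_side n k 0)
    (nat ((int j - int (\<Sum>l<k. D l)) mod int d), left_side n 0 0)"
proof -
  define m where "m = nat ((int j - int (\<Sum>l<k. D l)) mod int d)"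
  have m: "int m = (int j - int (\<Sum>l<k. D l)) mod int d" "m < d"
    using d_pos by (auto simp: m_def nat_less_iff)
  have "int ((m + (\<Sum>l<k. D l)) mod d) = int j mod int d"
    unfolding zmod_int of_nat_add m(1) mod_add_left_eq by simp
  then have "(m + (\<Sum>l<k. D l)) mod d = j" using assms(2) by simp
  then have "equivclp glue (m, left_side n 0 0) (j, left_side n k 0)"
    using equiv_over_base_shift[OF assms(1) m(2)] by simp
  then show ?thesis unfolding m_def by (rule equivclp_sym)
qed

text \<open>The source of completeness: gluings carry every point to a representative that depends
  only on its label.\<close>

lemma equiv_rep_label:
  assumes "j < d" "norm z \<le> 1"
  shows "equivclp glue (j, z) (rep (label (j, z)))"
proof (cases "norm z < 1")
  case True
  then show ?thesis by (simp add: label_face)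
next
  case False
  then have "norm z = 1" using assms by simp
  then show ?thesis using n_pos
  proof (cases rule: unit_circle_cases)
    case (left k t)
    then show ?thesis
      using assms equiv_over_base[of k j] equiv_over_end[of k j] label_left[of k t j]
      by (cases "t = 1") auto
  next
    case (right k t)
    \<comment> \<open>The sheet whose \<open>k\<close>-th left side is glued to the
      \<open>k\<close>-th right side of sheet \<open>j\<close>.\<close>
    define i where "i = nat ((int j - int (D k)) mod int d)"
    have i: "int i = (int j - int (D k)) mod int d" "i < d"
      using d_pos by (auto simp: i_def nat_less_iff)
    have "int ((i + D k) mod d) = int j mod int d"
      unfolding zmod_int of_nat_add i(1) mod_add_left_eq by simp
    then have "(i + D k) mod d = j" using assms by simp
    then have "glue (i, left_side n k t) (j, right_side n k t)"
      using glue.intros[of k i t] i(2) right by simp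
    then show ?thesis
      using right i by (auto simp: label_right i_def intro: equivclp_sym r_into_equivclp)
  qed
qed

lemma equiv_iff_label:
  assumes "j < d" "norm z \<le> 1" "j' < d" "norm z' \<le> 1"
  shows "equivclp glue (j, z) (j', z') \<longleftrightarrow> label (j, z) = label (j', z')"
proof
  assume "label (j, z) = label (j', z')"
  then show "equivclp glue (j, z) (j', z')"
    using equiv_rep_label assms by (metis equivclp_sym equivclp_trans)
qed (rule label_equiv)

section \<open>Labels on the boundary circle and the number of vertices\<close>

definition vertex_labels :: "cell_point set" where
  "vertex_labels = Over_base ` int ` {..<d} \<union> (\<Union>k<n. Over_end k ` {..<gcd d (D k)})"

lemma card_vertex_labels: "card vertex_labels = d + (\<Sum>k<n. gcd d (D k))"
proof -
  have "card (\<Union>k<n. Over_end k ` {..<gcd d (D k)}) = (\<Sum>k<n. gcd d (D k))"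
    by (subst card_UN_disjoint) (auto simp: card_image inj_on_def)
  moreover have "card (Over_base ` int ` {..<d}) = d"
    by (simp add: card_image inj_on_def)
  ultimately show ?thesis
    unfolding vertex_labels_def by (subst card_Un_disjoint) auto
qed

lemma finite_vertex_labels: "finite vertex_labels"
  by (simp add: vertex_labels_def)

lemma rep_vertex_label:
  assumes "l \<in> vertex_labels"
  shows "fst (rep l) < d" "norm (snd (rep l)) \<le> 1" "label (rep l) = l"
proof -
  \<comment> \<open>An orbit number below the gcd is therefore also a sheet number.\<close>
  have gcd_le: "gcd d (D k) \<le> d" for k using d_pos by (simp add: gcd_le1_nat)
  show "fst (rep l) < d" "norm (snd (rep l)) \<le> 1" "label (rep l) = l"
    using assms n_pos order.strict_trans2[OF _ gcd_le]
    by (auto simp: vertex_labels_def label_left)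
qed

lemma left_end_label:
  assumes "k < n" "j < d" "t \<in> {0, 1}"
  shows "label (j, left_side n k t) \<in> vertex_labels"
proof -
  have "(int j - int (\<Sum>l<k. D l)) mod int d \<in> int ` {..<d}"
    using d_pos by (intro image_eqI[of _ _ "nat ((int j - int (\<Sum>l<k. D l)) mod int d)"])
      (auto simp: nat_less_iff)
  then show ?thesis
    using assms d_pos by (auto simp: vertex_labels_def label_left intro!: bexI[of _ k])
qed

lemma circle_label_cases:
  assumes "j < d" "norm z = 1"
  shows "label (j, z) \<in> vertex_labels \<or>
    (\<exists>k<n. \<exists>i<d. \<exists>t\<in>{0<..<1}. label (j, z) = On_edge k t (int i))"
  using assms(2) n_pos
proof (cases rule: unit_circle_cases)
  case (left k t)
  then show ?thesis
    using assms left_end_label[of k j t] label_left[of k t j]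
    by (cases "t = 0 \<or> t = 1") auto
next
  case (right k t)
  define i where "i = nat ((int j - int (D k)) mod int d)"
  have "int i = (int j - int (D k)) mod int d" "i < d"
    using d_pos by (auto simp: i_def nat_less_iff)
  moreover from this have "label (j, z) = On_edge k t (int i)" using right by (simp add: label_right)
  ultimately show ?thesis using right by (meson greaterThanLessThan_iff)
qed

end

section \<open>The cell decomposition of the cover\<close>

lemma topspace_sheets: "topspace (sheets d) = {..<d} \<times> cball 0 1"
  by (simp add: sheets_def)

section \<open>Cells as images of discs, sides and corners\<close>

locale glued_surface = cyclic_gluing +
  fixes X :: "'a topology" and \<pi> :: "nat \<times> complex \<Rightarrow> 'a"
  assumes quotient: "quotient_map (sheets d) X \<pi>"
    and fibres: "\<And>a b. \<lbrakk>a \<in> topspace (sheets d); b \<in> topspace (sheets d)\<rbrakk> \<Longrightarrow>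
      \<pi> a = \<pi> b \<longleftrightarrow> equivclp glue a b"
begin

text \<open>Turns every coincidence of points of \<open>X\<close> into a comparison of
  labels.\<close>

lemma proj_eq_iff:
  assumes "j < d" "norm z \<le> 1" "j' < d" "norm z' \<le> 1"
  shows "\<pi> (j, z) = \<pi> (j', z') \<longleftrightarrow> label (j, z) = label (j', z')"
  using assms fibres equiv_iff_label by (auto simp: topspace_sheets)

lemma topspace_eq: "topspace X = \<pi> ` ({..<d} \<times> cball 0 1)"
  using quotient_imp_surjective_map[OF quotient] by (simp add: topspace_sheets)

lemma continuous_map_sheet:
  assumes "j < d" "continuous_on S h" "h ` S \<subseteq> cball 0 1"
  shows "continuous_map (top_of_set S) X (\<lambda>x. \<pi> (j, h x))"
proof -
  have "continuous_map (top_of_set S) (sheets d) (\<lambda>x. (j, h x))"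
    unfolding sheets_def using assms
    by (intro continuous_map_pairedI) (auto simp: continuous_map_in_subtopology)
  then show ?thesis
    using continuous_map_compose[OF _ quotient_imp_continuous_map[OF quotient]]
    by (fastforce simp: o_def)
qed

definition vertices :: "'a set" where
  "vertices = \<pi> ` rep ` vertex_labels"

text \<open>Left sides suffice, because each right side is glued to a left side.\<close>

definition edge :: "nat \<times> nat \<Rightarrow> 'a set" where
  "edge = (\<lambda>(k, j). (\<lambda>t. \<pi> (j, left_side n k t)) ` {0<..<1})"

definition face :: "nat \<Rightarrow> 'a set" where
  "face j = (\<lambda>z. \<pi> (j, z)) ` ball 0 1"

lemma proj_rep_eq_iff:
  assumes "l \<in> vertex_labels" "j < d" "norm z \<le> 1"
  shows "\<pi> (j, z) = \<pi> (rep l) \<longleftrightarrow> label (j, z) = l"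
proof -
  obtain i w where r: "rep l = (i, w)" by fastforce
  then show ?thesis
    using rep_vertex_label[OF assms(1)] assms(2,3) proj_eq_iff[of j z i w] by simp
qed

lemma proj_in_vertices_iff:
  assumes "j < d" "norm z \<le> 1"
  shows "\<pi> (j, z) \<in> vertices \<longleftrightarrow> label (j, z) \<in> vertex_labels"
  using assms by (auto simp: vertices_def image_iff proj_rep_eq_iff)

lemma proj_in_edge_iff:
  assumes "j < d" "norm z \<le> 1" "k < n" "i < d"
  shows "\<pi> (j, z) \<in> edge (k, i) \<longleftrightarrow> (\<exists>t\<in>{0<..<1}. label (j, z) = On_edge k t (int i))"
  unfolding edge_def prod.case image_iff
  using assms by (intro bex_cong) (simp_all add: proj_eq_iff label_left)

lemma proj_in_face_iff:
  assumes "j < d" "norm z \<le> 1" "i < d"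
  shows "\<pi> (j, z) \<in> face i \<longleftrightarrow> (\<exists>w\<in>ball 0 1. label (j, z) = In_face i w)"
  unfolding face_def image_iff
  using assms by (intro bex_cong) (simp_all add: proj_eq_iff label_face)

lemma vertex_labels_not_cell [simp]:
  "On_edge k t m \<notin> vertex_labels" "In_face j z \<notin> vertex_labels"
  by (auto simp: vertex_labels_def)

lemma card_vertices: "card vertices = d + (\<Sum>k<n. gcd d (D k))"
proof -
  have "inj_on (\<pi> \<circ> rep) vertex_labels"
  proof (rule inj_onI)
    fix l l' assume l: "l \<in> vertex_labels" "l' \<in> vertex_labels" "(\<pi> \<circ> rep) l = (\<pi> \<circ> rep) l'"
    obtain i w where "rep l = (i, w)" by fastforce
    then show "l = l'"
      using l rep_vertex_label[OF l(1)] proj_rep_eq_iff[OF l(2), of i w] by simp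
  qed
  then show ?thesis
    unfolding vertices_def image_comp by (simp only: card_image card_vertex_labels)
qed

text \<open>Labels separate the edges. As edges are nonempty, disjointness also makes the indexing
  injective, which the count needs.\<close>

lemma inj_on_edge: "inj_on edge ({..<n} \<times> {..<d})"
  and disjoint_edges: "disjoint (edge ` ({..<n} \<times> {..<d}))"
proof -
  have *: "edge p \<inter> edge p' = {}"
    if p: "p \<in> {..<n} \<times> {..<d}" "p' \<in> {..<n} \<times> {..<d}" "p \<noteq> p'" for p p'
  proof -
    obtain k j k' j' where eq: "p = (k, j)" "p' = (k', j')" by fastforce
    have "\<pi> (j, left_side n k t) \<notin> edge p'" if "t \<in> {0<..<1}" for t
      using p that by (auto simp: eq proj_in_edge_iff label_left)
    then show ?thesis unfolding eq(1) by (subst edge_def) auto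
  qed
  then show "disjoint (edge ` ({..<n} \<times> {..<d}))"
    unfolding pairwise_def disjnt_def by blast
  have "edge p \<noteq> {}" for p by (simp add: edge_def split: prod.splits)
  with * show "inj_on edge ({..<n} \<times> {..<d})" by (metis inf.idem inj_onI)
qed

lemma inj_on_face: "inj_on face {..<d}" and disjoint_faces: "disjoint (face ` {..<d})"
proof -
  have *: "face i \<inter> face j = {}" if "i \<in> {..<d}" "j \<in> {..<d}" "i \<noteq> j" for i j
  proof -
    have "\<pi> (i, z) \<notin> face j" if z: "z \<in> ball 0 1" for z
      using \<open>i \<in> _\<close> \<open>j \<in> _\<close> \<open>i \<noteq> j\<close> z by (auto simp: proj_in_face_iff label_face)
    then show ?thesis by (subst face_def) auto
  qed
  then show "disjoint (face ` {..<d})"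
    unfolding pairwise_def disjnt_def by blast
  have "face i \<noteq> {}" for i by (simp add: face_def)
  with * show "inj_on face {..<d}" by (metis inf.idem inj_onI)
qed

lemma proj_circle:
  assumes "j < d" "norm z = 1"
  shows "\<pi> (j, z) \<in> vertices \<union> \<Union> (edge ` ({..<n} \<times> {..<d}))"
  using circle_label_cases[OF assms]
proof (elim disjE exE conjE bexE)
  assume "label (j, z) \<in> vertex_labels"
  then show ?thesis using assms by (simp add: proj_in_vertices_iff)
next
  fix k i t
  assume "k < n" "i < d" "t \<in> {0<..<1}" "label (j, z) = On_edge k t (int i)"
  moreover from this have "\<pi> (j, z) \<in> edge (k, i)"
    using assms by (auto simp: proj_in_edge_iff)
  ultimately show ?thesis by blast
qed

text \<open>The characteristic maps are the left sides and the sheets themselves; disjointness of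
  the kinds of cells comes from the different constructors of their labels.\<close>

lemma cell_decomposition_cover:
  "cell_decomposition X vertices (edge ` ({..<n} \<times> {..<d})) (face ` {..<d})"
proof -
  let ?E = "edge ` ({..<n} \<times> {..<d})" and ?F = "face ` {..<d}"
  have vX: "vertices \<subseteq> topspace X"
    using rep_vertex_label unfolding vertices_def topspace_eq
    by (force simp: mem_Times_iff)
  have eX: "\<Union>?E \<subseteq> topspace X" by (auto simp: edge_def topspace_eq)
  have fX: "\<Union>?F \<subseteq> topspace X" by (auto simp: face_def topspace_eq)
  have cover: "topspace X \<subseteq> vertices \<union> \<Union>?E \<union> \<Union>?F"
  proof
    fix x assume "x \<in> topspace X"
    then obtain j z where x: "x = \<pi> (j, z)" "j < d" "norm z \<le> 1"
      by (auto simp: topspace_eq)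
    show "x \<in> vertices \<union> \<Union>?E \<union> \<Union>?F"
    proof (cases "norm z = 1")
      case True
      then show ?thesis using x proj_circle by blast
    next
      case False
      then have "x \<in> face j" using x by (simp add: face_def)
      then show ?thesis using x by blast
    qed
  qed
  have VE: "vertices \<inter> \<Union>?E = {}"
    by (auto simp: edge_def proj_in_vertices_iff label_left)
  have VF: "vertices \<inter> \<Union>?F = {}"
    by (auto simp: face_def proj_in_vertices_iff label_face)
  have EF: "\<Union>?E \<inter> \<Union>?F = {}"
  proof -
    have False if x: "x \<in> edge (k, i)" "x \<in> face j" "k < n" "i < d" "j < d" for x k i j
    proof -
      obtain z where "x = \<pi> (j, z)" "norm z < 1" using x(2) by (auto simp: face_def)
      then show False using x by (auto simp: proj_in_edge_iff label_face)
    qed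
    then show ?thesis by blast
  qed
  have edges: "\<exists>h. continuous_map (top_of_set {0..1::real}) X h \<and>
      inj_on h {0<..<1} \<and> h ` {0<..<1} = e \<and> h ` {0, 1} \<subseteq> vertices" if "e \<in> ?E" for e
  proof -
    obtain k j where e: "k < n" "j < d" "e = edge (k, j)" using \<open>e \<in> ?E\<close> by auto
    let ?h = "\<lambda>t. \<pi> (j, left_side n k t)"
    have "continuous_on {0..1} (left_side n k)"
      unfolding left_side_def[abs_def] using n_pos by (auto intro!: continuous_intros)
    then have "continuous_map (top_of_set {0..1}) X ?h"
      using e by (intro continuous_map_sheet) auto
    moreover have "inj_on ?h {0<..<1}"
      using e by (intro inj_onI) (simp add: proj_eq_iff label_left)
    moreover have "?h ` {0, 1} \<subseteq> vertices"
      using e left_end_label by (auto simp: proj_in_vertices_iff)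
    moreover have "?h ` {0<..<1} = e" using e by (simp add: edge_def)
    ultimately show ?thesis by blast
  qed
  have faces: "\<exists>h. continuous_map (top_of_set (cball (0::complex) 1)) X h \<and>
      inj_on h (ball 0 1) \<and> h ` ball 0 1 = c \<and> h ` sphere 0 1 \<subseteq> vertices \<union> \<Union>?E"
    if "c \<in> ?F" for c
  proof -
    obtain j where c: "j < d" "c = face j" using \<open>c \<in> ?F\<close> by auto
    let ?h = "\<lambda>z. \<pi> (j, z)"
    have "continuous_map (top_of_set (cball 0 1)) X ?h"
      using c by (intro continuous_map_sheet) auto
    moreover have "inj_on ?h (ball 0 1)"
      using c by (intro inj_onI) (simp add: proj_eq_iff label_face)
    moreover have "?h ` sphere 0 1 \<subseteq> vertices \<union> \<Union>?E"
      using c by (intro image_subsetI proj_circle) auto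
    moreover have "?h ` ball 0 1 = c" using c by (simp add: face_def)
    ultimately show ?thesis by blast
  qed
  have union: "vertices \<union> \<Union>?E \<union> \<Union>?F = topspace X"
    using vX eX fX cover by (intro equalityI Un_least)
  have finite: "finite vertices" "finite ?E" "finite ?F"
    by (simp_all add: vertices_def finite_vertex_labels)
  show ?thesis
    unfolding cell_decomposition_def
    by (intro conjI ballI finite union VE VF EF disjoint_edges disjoint_faces edges faces)
qed

text \<open>The term \<open>2 * int d\<close> collects the faces and the vertices over the base
  point.\<close>

lemma euler_characteristic:
  assumes "has_euler_characteristic X c"
  shows "c = 2 * int d + (\<Sum>k<n. int (gcd d (D k))) - int n * int d"
proof -
  have "c = int (card vertices) - int (card (edge ` ({..<n} \<times> {..<d}))) + int (card (face ` {..<d}))"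
    using assms cell_decomposition_cover unfolding has_euler_characteristic_def by metis
  then show ?thesis
    by (simp add: card_vertices card_image inj_on_edge inj_on_face)
qed

end

section \<open>The Riemann-Hurwitz formula\<close>

text \<open>The fibre over the \<open>i\<close>-th branch point has \<open>gcd d (ds ! i)\<close>
  points, one for each orbit of its shift on the sheets.\<close>

lemma riemann_hurwitz_cyclic:
  assumes "cyclic_branched_cover n d ds X" "has_genus X g" "n > 0"
  shows "2 * real g - 2 = real d * (real n - 2) - (\<Sum>i<n. real (gcd d (ds ! i)))"
proof -
  obtain p f where "cyclic_branched_cover_over n p d ds X f"
    using assms(1) unfolding cyclic_branched_cover_def by blast
  then obtain q \<gamma> \<phi> s \<pi> where bd: "branching_data n d ds" and slit: "slit_sphere n \<gamma> \<phi> s"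
    and quot: "quotient_map (sheets d) X \<pi>"
    and fib: "\<And>a b. \<lbrakk>a \<in> topspace (sheets d); b \<in> topspace (sheets d)\<rbrakk> \<Longrightarrow>
      \<pi> a = \<pi> b \<longleftrightarrow> equivclp (side_gluing n d ds s) a b"
    unfolding cyclic_branched_cover_over_def by blast
  have s: "bij_betw s {..<n} {..<n}" using slit by (simp add: slit_sphere_def)
  \<comment> \<open>Carries the branching indices from the numbering of the cuts to their boundary
    positions; sums over all cuts do not notice this.\<close>
  define D where "D k = ds ! inv_into {..<n} s k" for k
  have D_s: "D (s i) = ds ! i" if "i < n" for i
    using that s by (simp add: D_def bij_betw_def)
  have reindex: "(\<Sum>k<n. h (D k)) = (\<Sum>i<n. h (ds ! i))" for h :: "nat \<Rightarrow> nat"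
    using sum.reindex_bij_betw[OF s, of "\<lambda>k. h (D k)"] D_s by simp
  have "(\<Sum>k<n. D k) = sum_list ds"
    using reindex[of "\<lambda>x. x"] bd by (simp add: branching_data_def sum_list_sum_nth atLeast0LessThan)
  then interpret cyclic_gluing n d D
    using assms(3) bd by unfold_locales (auto simp: branching_data_def)
  have "side_gluing n d ds s a b = glue a b" for a b
  proof
    assume "side_gluing n d ds s a b"
    then show "glue a b"
    proof cases
      case (1 i j t)
      then have "s i < n" using s by (auto simp: bij_betw_def)
      with 1 show ?thesis using glue.intros[of "s i" j t] D_s by simp
    qed
  next
    assume "glue a b"
    then show "side_gluing n d ds s a b"
    proof cases
      case (1 k j t)
      then obtain i where "i < n" "k = s i" using s by (auto simp: bij_betw_def)
      with 1 show ?thesis using side_gluing.intros[of i n j d t ds s] D_s by simp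
    qed
  qed
  then have "side_gluing n d ds s = glue" by blast
  then interpret glued_surface n d D X \<pi>
    using quot fib by unfold_locales auto
  have "2 - 2 * int g = 2 * int d + (\<Sum>k<n. int (gcd d (D k))) - int n * int d"
    using assms(2) by (intro euler_characteristic) (simp add: has_genus_def)
  then have "2 - 2 * int g = 2 * int d + (\<Sum>i<n. int (gcd d (ds ! i))) - int n * int d"
    using arg_cong[OF reindex[of "gcd d"], of int] by simp
  then have "real_of_int (2 - 2 * int g) =
      real_of_int (2 * int d + (\<Sum>i<n. int (gcd d (ds ! i))) - int n * int d)"
    by presburger
  then show ?thesis by (simp add: algebra_simps)
qed

section \<open>Bounds on the degree\<close>

text \<open>The extremal triple is (2, 3, 7), the signature behind the Hurwitz bound.\<close>

lemma sum_unit_fractions_3: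
  fixes a b c :: nat
  assumes "2 \<le> a" "2 \<le> b" "2 \<le> c" "1 / real a + 1 / real b + 1 / real c < 1"
  shows "1 / real a + 1 / real b + 1 / real c \<le> 41 / 42"
proof -
  have le: "1 / real x \<le> 1 / numeral m" if "numeral m \<le> x" for x m
    using that by (intro frac_le) (auto simp: numeral_le_real_of_nat_iff)
  have sorted: "1 / real a + 1 / real b + 1 / real c \<le> 41 / 42"
    if "2 \<le> a" "a \<le> b" "b \<le> c" "1 / real a + 1 / real b + 1 / real c < 1" for a b c :: nat
  proof -
    \<comment> \<open>The triples (2, 2, c), (2, 3, c) with c at most 6, (2, 4, 4) and (3, 3, 3)
      have sum at least 1. The other cases are largest at (2, 3, 7), (2, 4, 5), (2, 5, 5), (3, 3,
      4), (3, 4, 4) and (4, 4, 4).\<close>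
    have "(a = 2 \<and> b = 2) \<or> (a = 2 \<and> b = 3 \<and> c \<le> 6) \<or> (a = 2 \<and> b = 3 \<and> 7 \<le> c)
        \<or> (a = 2 \<and> b = 4 \<and> c = 4) \<or> (a = 2 \<and> b = 4 \<and> 5 \<le> c) \<or> (a = 2 \<and> 5 \<le> b \<and> 5 \<le> c)
        \<or> (a = 3 \<and> b = 3 \<and> c = 3) \<or> (a = 3 \<and> b = 3 \<and> 4 \<le> c) \<or> (a = 3 \<and> 4 \<le> b \<and> 4 \<le> c)
        \<or> (4 \<le> a \<and> 4 \<le> b \<and> 4 \<le> c)"
      using that(1-3) by presburger
    then show ?thesis
    proof (elim disjE conjE, goal_cases)
      case 1
      then show ?thesis using that(4) by simp
    next
      case 2
      then have "1 / 6 \<le> 1 / real c" using that(3) by (simp add: field_simps)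
      then show ?thesis using 2 that(4) by simp
    next
      case 3
      show ?thesis
        unfolding 3(1,2) using le[OF 3(3)] by linarith
    next
      case 4
      then show ?thesis using that(4) by simp
    next
      case 5
      show ?thesis
        unfolding 5(1,2) using le[OF 5(3)] by linarith
    next
      case 6
      show ?thesis
        unfolding 6(1) using le[OF 6(2)] le[OF 6(3)] by linarith
    next
      case 7
      then show ?thesis using that(4) by simp
    next
      case 8
      show ?thesis
        unfolding 8(1,2) using le[OF 8(3)] by linarith
    next
      case 9
      show ?thesis
        unfolding 9(1) using le[OF 9(2)] le[OF 9(3)] by linarith
    next
      case 10
      show ?thesis
        using le[OF 10(1)] le[OF 10(2)] le[OF 10(3)] by linarith
    qed
  qed
  consider "a \<le> b" "b \<le> c" | "a \<le> c" "c \<le> b" | "b \<le> a" "a \<le> c" | "b \<le> c" "c \<le> a"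
    | "c \<le> a" "a \<le> b" | "c \<le> b" "b \<le> a" by linarith
  then show ?thesis
    using assms sorted[of a b c] sorted[of a c b] sorted[of b a c] sorted[of b c a]
      sorted[of c a b] sorted[of c b a]
    by cases (simp_all add: add_ac)
qed

text \<open>A sum below 2 forces some denominator to be at least 3; the extremal case is (2, 2, 2,
  3).\<close>

lemma sum_unit_fractions_4:
  fixes a b c e :: nat
  assumes "2 \<le> a" "2 \<le> b" "2 \<le> c" "2 \<le> e"
    and "1 / real a + 1 / real b + 1 / real c + 1 / real e < 2"
  shows "1 / real a + 1 / real b + 1 / real c + 1 / real e \<le> 11 / 6"
proof -
  have *: "1 / real x = 1 / 2 \<or> 1 / real x \<le> 1 / 3" "1 / real x \<le> 1 / 2" if "2 \<le> x" for x :: nat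
  proof -
    show "1 / real x \<le> 1 / 2" using that by (simp add: frac_le)
    show "1 / real x = 1 / 2 \<or> 1 / real x \<le> 1 / 3"
      using that by (cases "x = 2") (auto simp: field_simps)
  qed
  show ?thesis
    using *[OF assms(1)] *[OF assms(2)] *[OF assms(3)] *[OF assms(4)] assms(5) by linarith
qed

text \<open>Here \<open>e\<close> is the order of \<open>x\<close> in the integers mod
  \<open>d\<close>, that is, the ramification index; it exceeds 1 because \<open>x\<close> is
  nonzero mod \<open>d\<close>.\<close>

lemma gcd_eq_divide_ramification:
  fixes d x :: nat
  assumes "1 \<le> x" "x \<le> d - 1"
  obtains e where "2 \<le> e" "real (gcd d x) = real d * (1 / real e)"
proof -
  obtain e where e: "d = gcd d x * e" by (meson dvdE gcd_dvd1)
  have "gcd d x < d" using assms gcd_le2_nat[of x d] by linarith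
  then have "e \<noteq> 0" "e \<noteq> 1" using e by (metis mult_0_right not_less_zero, metis mult_1_right less_irrefl)
  then have "2 \<le> e" by simp
  moreover have "real d = real (gcd d x) * real e" using e by (metis of_nat_mult)
  ultimately show thesis using that[of e] by simp
qed

section \<open>The degree bounds and finiteness\<close>

lemma cover_degree_bounds:
  assumes "cyclic_branched_cover n d ds X" "has_genus X g" "n \<ge> 3" "g \<ge> 2"
  shows "n = 3 \<Longrightarrow> real d \<le> 84 * (real g - 1)"
    and "n = 4 \<Longrightarrow> real d \<le> 12 * (real g - 1)"
    and "n \<ge> 5 \<Longrightarrow> 2 * real g / (real n - 2) + 1 \<le> real d"
    and "n \<ge> 5 \<Longrightarrow> real d \<le> 4 * (real g - 1) / (real n - 4)"
proof -
  have bd: "branching_data n d ds"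
    using assms(1) by (auto simp: cyclic_branched_cover_def cyclic_branched_cover_over_def)
  then have d: "d \<ge> 2" by (simp add: branching_data_def)
  have "ds ! i \<in> {1..d - 1}" if "i < n" for i
    using bd that unfolding branching_data_def by (metis nth_mem subsetD)
  then have "\<forall>i. \<exists>e. i < n \<longrightarrow> 2 \<le> e \<and> real (gcd d (ds ! i)) = real d * (1 / real e)"
    by (metis atLeastAtMost_iff gcd_eq_divide_ramification)
  then obtain e where e: "\<And>i. i < n \<Longrightarrow> 2 \<le> e i"
      "\<And>i. i < n \<Longrightarrow> real (gcd d (ds ! i)) = real d * (1 / real (e i))"
    by metis
  have rh: "2 * real g - 2 = real d * (real n - 2) - (\<Sum>i<n. real (gcd d (ds ! i)))"
    using riemann_hurwitz_cyclic assms by force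
  have rh': "2 * real g - 2 = real d * (real n - 2 - (\<Sum>i<n. 1 / real (e i)))"
    using rh e(2) by (simp add: sum_distrib_left algebra_simps)
  moreover have "0 < 2 * real g - 2" using assms by simp
  \<comment> \<open>Genus at least 2 makes the factor of \<open>real d\<close> positive, which is
    the strict inequality required of the unit fractions.\<close>
  ultimately have pos: "(\<Sum>i<n. 1 / real (e i)) < real n - 2"
    using d by (simp add: zero_less_mult_iff)
  show "real d \<le> 84 * (real g - 1)" if n: "n = 3"
  proof -
    have S: "(\<Sum>i<n. 1 / real (e i)) = 1 / real (e 0) + 1 / real (e 1) + 1 / real (e 2)"
      by (simp add: n eval_nat_numeral)
    then have "(\<Sum>i<n. 1 / real (e i)) \<le> 41 / 42"
      using sum_unit_fractions_3[of "e 0" "e 1" "e 2"] e(1) pos n by simp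
    \<comment> \<open>The factor 1/42 is 3 - 2 - 41/42.\<close>
    then have "real d * (1 / 42) \<le> 2 * real g - 2"
      unfolding rh' using n by (intro mult_left_mono) auto
    then show ?thesis by simp
  qed
  show "real d \<le> 12 * (real g - 1)" if n: "n = 4"
  proof -
    have S: "(\<Sum>i<n. 1 / real (e i)) =
        1 / real (e 0) + 1 / real (e 1) + 1 / real (e 2) + 1 / real (e 3)"
      by (simp add: n eval_nat_numeral)
    then have "(\<Sum>i<n. 1 / real (e i)) \<le> 11 / 6"
      using sum_unit_fractions_4[of "e 0" "e 1" "e 2" "e 3"] e(1) pos n by simp
    \<comment> \<open>The factor 1/6 is 4 - 2 - 11/6.\<close>
    then have "real d * (1 / 6) \<le> 2 * real g - 2"
      unfolding rh' using n by (intro mult_left_mono) auto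
    then show ?thesis by simp
  qed
  show "2 * real g / (real n - 2) + 1 \<le> real d" if n: "n \<ge> 5"
  proof -
    \<comment> \<open>Each gcd is at least 1, so 2g - 2 is at most d(n - 2) - n, which equals (d -
      1)(n - 2) - 2.\<close>
    have "(\<Sum>i<n. 1) \<le> (\<Sum>i<n. real (gcd d (ds ! i)))"
      using d by (intro sum_mono) (simp add: Suc_le_eq)
    then have "2 * real g \<le> (real d - 1) * (real n - 2)"
      using rh by (simp add: algebra_simps)
    then show ?thesis using n by (simp add: field_simps)
  qed
  show "real d \<le> 4 * (real g - 1) / (real n - 4)" if n: "n \<ge> 5"
  proof -
    \<comment> \<open>With every ramification index at least 2, the factor of \<open>real d\<close>
      is at least n/2 - 2, which is positive for \<open>n \<ge> 5\<close>.\<close>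
    have "(\<Sum>i<n. 1 / real (e i)) \<le> (\<Sum>i<n. 1 / 2)"
      using e(1) by (intro sum_mono frac_le) (auto intro: of_nat_mono[of 2, simplified])
    then have "real d * (real n / 2 - 2) \<le> 2 * real g - 2"
      unfolding rh' by (intro mult_left_mono) auto
    then show ?thesis using n by (simp add: field_simps)
  qed
qed

text \<open>The entries of \<open>ds\<close> lie below \<open>d\<close>, so a bound on the degree
  bounds them too.\<close>

lemma finite_branching_data: "finite {(d, ds). d \<le> N \<and> branching_data n d ds}"
proof (rule finite_subset)
  show "{(d, ds). d \<le> N \<and> branching_data n d ds} \<subseteq>
      {..N} \<times> {ds. set ds \<subseteq> {..N} \<and> length ds = n}"
    by (force simp: branching_data_def)
  show "finite ({..N} \<times> {ds. set ds \<subseteq> {..N} \<and> length ds = n})"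
    by (intro finite_cartesian_product finite_lists_length_eq) auto
qed

theorem theorem3p2:
  fixes n g :: nat
  assumes "n \<ge> 3" and "g \<ge> 2"
  shows "finite {(d, ds). \<exists>X :: 'a topology.
            cyclic_branched_cover n d ds X \<and> connected_space X \<and> has_genus X g} \<and>
    (\<forall>d ds. \<forall>X :: 'a topology.
        cyclic_branched_cover n d ds X \<and> connected_space X \<and> has_genus X g \<longrightarrow>
        (n = 3 \<longrightarrow> real d \<le> 84 * (real g - 1)) \<and>
        (n = 4 \<longrightarrow> real d \<le> 12 * (real g - 1)) \<and>
        (n \<ge> 5 \<longrightarrow> 2 * real g / (real n - 2) + 1 \<le> real d \<and>
                  real d \<le> 4 * (real g - 1) / (real n - 4)))"
proof
  \<comment> \<open>The upper bound for \<open>n = 3\<close> is the weakest of the three and serves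
    every \<open>n\<close>; \<open>84 * g\<close> avoids subtraction on \<open>nat\<close>.\<close>
  have "d \<le> 84 * g \<and> branching_data n d ds"
    if "cyclic_branched_cover n d ds X" "has_genus X g" for d ds and X :: "'a topology"
  proof
    note bounds = cover_degree_bounds[OF that assms]
    consider "n = 3" | "n = 4" | "n \<ge> 5" using assms by linarith
    then have "real d \<le> 84 * (real g - 1)"
    proof cases
      case 1
      then show ?thesis using bounds by simp
    next
      case 2
      then show ?thesis using bounds(2) assms by simp
    next
      case 3
      \<comment> \<open>The denominator is at least 1 for \<open>n \<ge> 5\<close>.\<close>
      have "4 * (real g - 1) / (real n - 4) \<le> 4 * (real g - 1) / 1"
        using 3 assms by (intro divide_left_mono) auto
      then show ?thesis using bounds(4)[OF 3] assms by simp
    qed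
    then have "real d \<le> real (84 * g)" by simp
    then show "d \<le> 84 * g" by (simp only: of_nat_le_iff)
    show "branching_data n d ds"
      using that by (auto simp: cyclic_branched_cover_def cyclic_branched_cover_over_def)
  qed
  then show "finite {(d, ds). \<exists>X :: 'a topology.
      cyclic_branched_cover n d ds X \<and> connected_space X \<and> has_genus X g}"
    by (intro finite_subset[OF _ finite_branching_data[of "84 * g" n]]) blast
qed (use cover_degree_bounds[OF _ _ assms] in blast)

end
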